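(* Let $\tau=k+\theta$ with $k\in\mathbb{N}_0$, and let $h$ be a 1:1-periodic orbit, with phase $\alpha$ and no degenerate zeros, of $h'(t)=-\operatorname{sign}(h(t-\tau))+c\cos(2\pi t)$, with $h'(\alpha)>0$. The characteristic polynomial $\Delta(\lambda)$ (defined in the context) satisfies $$\Delta(\lambda)=[\lambda-1]\,\Delta_{2k+1}(\lambda)\ \text{ for }\theta\in(0,\tfrac12),\qquad \Delta(\lambda)=[\lambda-1]\,\Delta_{2k+2}(\lambda)\ \text{ for }\theta\in(\tfrac12,1),$$ where $$\Delta_{2k+1}(\lambda)=(\lambda-1)\lambda^{2k}+\frac{4}{h'(\alpha)}\lambda^{k}-\frac{4}{[h'(\alpha)]^2},$$ $$\Delta_{2k+2}(\lambda)=(\lambda-1)\lambda^{2k+1}+\frac{4}{h'(\alpha)}\lambda^{k+1}+\frac{4}{[h'(\alpha)]^2}.$$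
   Context: $c\ge0$, $\operatorname{sign}(0)=0$, $\mathbb{N}_0=\{0,1,2,\dots\}$. A 1:1-periodic orbit is a solution (locally absolutely continuous, satisfying the equation almost everywhere) on $\mathbb{R}$ of prime period $1$ with finitely many zeros per period and exactly one nondegenerate upward crossing of zero per period, located at the phase $\alpha$ (modulo $1$); a zero is nondegenerate if it is isolated and $h$ changes sign there, otherwise degenerate. Linearized map. Perturbations $\mathcal{E}(t)$ of the orbit, sampled at the zeros of $h$, satisfy to leading order the following pair of linear difference equations ($m\in\mathbb{Z}$). For $\theta\in(0,\tfrac12)$: $$\mathcal{E}(m+1+\alpha)=\mathcal{E}(m+\alpha)-\tfrac{2}{h'(\alpha)}\bigl[\mathcal{E}(m-k+\alpha)+\mathcal{E}(m-k+\alpha+\tfrac12)\bigr],$$ $$\mathcal{E}(m+\tfrac32+\alpha)=\mathcal{E}(m+\tfrac12+\alpha)-\tfrac{2}{h'(\alpha)}\bigl[\mathcal{E}(m-k+\alpha+\tfrac12)+\mathcal{E}(m-k+\alpha+1)\bigr].$$ For $\theta\in(\tfrac12,1)$: $$\mathcal{E}(m+1+\alpha)=\mathcal{E}(m+\alpha)-\tfrac{2}{h'(\alpha)}\bigl[\mathcal{E}(m-k-\tfrac12+\alpha)+\mathcal{E}(m-k+\alpha)\bigr],$$ $$\mathcal{E}(m+\tfrac32+\alpha)=\mathcal{E}(m+\tfrac12+\alpha)-\tfrac{2}{h'(\alpha)}\bigl[\mathcal{E}(m-k+\alpha)+\mathcal{E}(m-k+\alpha+\tfrac12)\bigr].$$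 Characteristic polynomial. Substitute the ansatz $$\begin{pmatrix}\mathcal{E}(m+\alpha)\\ \mathcal{E}(m+\alpha+\tfrac12)\end{pmatrix}=\lambda^m\begin{pmatrix}v_1\\ v_2\end{pmatrix},$$ move all terms to the left-hand side, and divide each of the two equations by the smallest power of $\lambda$ occurring in it. This yields a linear system $A(\lambda)(v_1,v_2)^{T}=0$ whose $2\times2$ matrix $A(\lambda)$ has polynomial entries; $\Delta(\lambda):=\det A(\lambda)$. *)

theory Defs
  imports "HOL-Analysis.Analysis" "HOL-Computational_Algebra.Polynomial"
begin

section \<open>Periodic orbits of the delay equation\<close>

definition abs_continuous_on_interval :: "(real \<Rightarrow> real) \<Rightarrow> real \<Rightarrow> real \<Rightarrow> bool" where
  "abs_continuous_on_interval h a b \<longleftrightarrow>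
     (\<forall>\<epsilon>>0. \<exists>\<delta>>0. \<forall>(n::nat) (x :: nat \<Rightarrow> real) y.
        (\<forall>i<n. a \<le> x i \<and> x i \<le> y i \<and> y i \<le> b) \<and>
        disjoint_family_on (\<lambda>i. {x i<..<y i}) {..<n} \<and>
        (\<Sum>i<n. y i - x i) < \<delta> \<longrightarrow>
        (\<Sum>i<n. \<bar>h (y i) - h (x i)\<bar>) < \<epsilon>)"

definition locally_abs_continuous :: "(real \<Rightarrow> real) \<Rightarrow> bool" where
  "locally_abs_continuous h \<longleftrightarrow> (\<forall>a b. a \<le> b \<longrightarrow> abs_continuous_on_interval h a b)"

definition dde_solution :: "real \<Rightarrow> real \<Rightarrow> (real \<Rightarrow> real) \<Rightarrow> bool" where
  "dde_solution \<tau> c h \<longleftrightarrow>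
     locally_abs_continuous h \<and>
     (AE t in lborel.
        (h has_real_derivative (- sgn (h (t - \<tau>)) + c * cos (2 * pi * t))) (at t))"

definition upward_crossing :: "(real \<Rightarrow> real) \<Rightarrow> real \<Rightarrow> bool" where
  "upward_crossing h z \<longleftrightarrow>
     h z = 0 \<and> (\<forall>\<^sub>F t in at_left z. h t < 0) \<and> (\<forall>\<^sub>F t in at_right z. 0 < h t)"

definition downward_crossing :: "(real \<Rightarrow> real) \<Rightarrow> real \<Rightarrow> bool" where
  "downward_crossing h z \<longleftrightarrow>
     h z = 0 \<and> (\<forall>\<^sub>F t in at_left z. 0 < h t) \<and> (\<forall>\<^sub>F t in at_right z. h t < 0)"

text \<open>For continuous \<open>h\<close> the sign is constant on each side of an isolated zero, so a change of
  sign there is one of the two crossings above (which makes the isolation conjunct redundant).\<close>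

definition nondegenerate_zero :: "(real \<Rightarrow> real) \<Rightarrow> real \<Rightarrow> bool" where
  "nondegenerate_zero h z \<longleftrightarrow>
     h z = 0 \<and> (\<forall>\<^sub>F t in at z. h t \<noteq> 0) \<and> (upward_crossing h z \<or> downward_crossing h z)"

definition degenerate_zero :: "(real \<Rightarrow> real) \<Rightarrow> real \<Rightarrow> bool" where
  "degenerate_zero h z \<longleftrightarrow> h z = 0 \<and> \<not> nondegenerate_zero h z"

definition prime_period :: "(real \<Rightarrow> real) \<Rightarrow> real \<Rightarrow> bool" where
  "prime_period h p \<longleftrightarrow>
     0 < p \<and> (\<forall>t. h (t + p) = h t) \<and> (\<forall>q. 0 < q \<and> q < p \<longrightarrow> \<not> (\<forall>t. h (t + q) = h t))"

definition one_one_periodic_orbit :: "real \<Rightarrow> real \<Rightarrow> real \<Rightarrow> (real \<Rightarrow> real) \<Rightarrow> bool" where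
  "one_one_periodic_orbit \<tau> c \<alpha> h \<longleftrightarrow>
     dde_solution \<tau> c h \<and>
     prime_period h 1 \<and>
     finite {t \<in> {0..<1}. h t = 0} \<and>
     (\<forall>t. upward_crossing h t \<longleftrightarrow> (\<exists>n::int. t = \<alpha> + of_int n))"


section \<open>The linearized map\<close>

text \<open>A linear difference equation for perturbations sampled at \<open>\<alpha> + \<int>/2\<close> is the list of its
  terms once everything is on the left-hand side: the pair \<open>(a, s)\<close> stands for
  \<open>a * \<E>(m + s/2 + \<alpha>)\<close>. Terms are kept apart rather than collected by power, because the power of
  \<open>\<lambda>\<close> to divide by is read off from the terms as written.\<close>

type_synonym difference_eq = "(real \<times> int) list"

definition satisfies_eq :: "real \<Rightarrow> (real \<Rightarrow> complex) \<Rightarrow> difference_eq \<Rightarrow> bool" where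
  "satisfies_eq \<alpha> \<E> L \<longleftrightarrow>
     (\<forall>m::int. (\<Sum>(a, s)\<leftarrow>L. of_real a * \<E> (of_int m + of_int s / 2 + \<alpha>)) = 0)"

text \<open>The parameter \<open>d\<close> is the slope \<open>h'(\<alpha>)\<close>; the delay is \<open>k + \<theta>\<close>. The branch taken at
  \<open>\<theta> = 1/2\<close> carries no meaning.\<close>

definition linearized_eq :: "nat \<Rightarrow> real \<Rightarrow> real \<Rightarrow> 2 \<Rightarrow> difference_eq" where
  "linearized_eq k \<theta> d i =
     (if \<theta> < 1/2 then
        (if i = 1
         then [(1, 2), (- 1, 0), (2 / d, - 2 * int k), (2 / d, - 2 * int k + 1)]
         else [(1, 3), (- 1, 1), (2 / d, - 2 * int k + 1), (2 / d, - 2 * int k + 2)])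
      else
        (if i = 1
         then [(1, 2), (- 1, 0), (2 / d, - 2 * int k - 1), (2 / d, - 2 * int k)]
         else [(1, 3), (- 1, 1), (2 / d, - 2 * int k), (2 / d, - 2 * int k + 1)]))"

lemma satisfies_linearized_eq_lower:
  assumes "\<theta> < 1/2"
  shows "satisfies_eq \<alpha> \<E> (linearized_eq k \<theta> d 1) \<longleftrightarrow>
      (\<forall>m::int. \<E> (m + 1 + \<alpha>) = \<E> (m + \<alpha>) - of_real (2 / d) * (\<E> (m - k + \<alpha>) + \<E> (m - k + \<alpha> + 1/2)))"
    and "satisfies_eq \<alpha> \<E> (linearized_eq k \<theta> d 2) \<longleftrightarrow>
      (\<forall>m::int. \<E> (m + 3/2 + \<alpha>) = \<E> (m + 1/2 + \<alpha>)
         - of_real (2 / d) * (\<E> (m - k + \<alpha> + 1/2) + \<E> (m - k + \<alpha> + 1)))"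
  using assms unfolding satisfies_eq_def linearized_eq_def
  by (auto simp: algebra_simps add_divide_distrib diff_divide_distrib add_eq_0_iff eq_neg_iff_add_eq_0)

lemma satisfies_linearized_eq_upper:
  assumes "1/2 < \<theta>"
  shows "satisfies_eq \<alpha> \<E> (linearized_eq k \<theta> d 1) \<longleftrightarrow>
      (\<forall>m::int. \<E> (m + 1 + \<alpha>) = \<E> (m + \<alpha>) - of_real (2 / d) * (\<E> (m - k - 1/2 + \<alpha>) + \<E> (m - k + \<alpha>)))"
    and "satisfies_eq \<alpha> \<E> (linearized_eq k \<theta> d 2) \<longleftrightarrow>
      (\<forall>m::int. \<E> (m + 3/2 + \<alpha>) = \<E> (m + 1/2 + \<alpha>)
         - of_real (2 / d) * (\<E> (m - k + \<alpha>) + \<E> (m - k + \<alpha> + 1/2)))"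
  using assms unfolding satisfies_eq_def linearized_eq_def
  by (auto simp: algebra_simps add_divide_distrib diff_divide_distrib add_eq_0_iff eq_neg_iff_add_eq_0)


section \<open>The characteristic polynomial\<close>

text \<open>Under the ansatz \<open>\<E>(m + \<alpha>) = \<lambda>\<^sup>m v\<^sub>1\<close>, \<open>\<E>(m + \<alpha> + 1/2) = \<lambda>\<^sup>m v\<^sub>2\<close> the term \<open>(a, s)\<close>
  becomes \<open>a \<lambda>\<^bsup>m + s div 2\<^esup>\<close> times \<open>v\<^sub>1\<close> for even and \<open>v\<^sub>2\<close> for odd \<open>s\<close>.\<close>

definition lowest_power :: "difference_eq \<Rightarrow> int" where
  "lowest_power L = Min ((\<lambda>(a, s). s div 2) ` set L)"

definition char_entry :: "difference_eq \<Rightarrow> 2 \<Rightarrow> complex poly" where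
  "char_entry L j =
     (\<Sum>(a, s)\<leftarrow>L. if even s \<longleftrightarrow> j = 1
        then monom (of_real a) (nat (s div 2 - lowest_power L)) else 0)"

lemma satisfies_eq_ansatz_iff:
  fixes z v\<^sub>1 v\<^sub>2 :: complex and \<alpha> :: real
  assumes "z \<noteq> 0"
    and v1: "\<And>m::int. \<E> (m + \<alpha>) = z powi m * v\<^sub>1"
    and v2: "\<And>m::int. \<E> (m + \<alpha> + 1/2) = z powi m * v\<^sub>2"
  shows "satisfies_eq \<alpha> \<E> L \<longleftrightarrow>
    poly (char_entry L 1) z * v\<^sub>1 + poly (char_entry L 2) z * v\<^sub>2 = 0"
proof -
  define e where "e = lowest_power L"
  have tm: "\<E> (of_int m + of_int s / 2 + \<alpha>) =
      z powi (m + s div 2) * (if even s then v\<^sub>1 else v\<^sub>2)" for m s :: int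
  proof (cases "even s")
    case True
    then obtain q where "s = 2 * q" by (elim evenE)
    then show ?thesis using v1[of "m + q"] by simp
  next
    case False
    then obtain q where q: "s = 2 * q + 1" by (elim oddE)
    then have "of_int m + of_int s / 2 + \<alpha> = of_int (m + q) + \<alpha> + 1/2"
      by (simp add: field_simps)
    then show ?thesis using v2[of "m + q"] q by (simp only:) simp
  qed
  have split: "(\<Sum>(a, s)\<leftarrow>M. of_real a * \<E> (of_int m + of_int s / 2 + \<alpha>)) =
      z powi (m + e) *
      (poly (\<Sum>(a, s)\<leftarrow>M. if even s \<longleftrightarrow> (1::2) = 1 then monom (of_real a) (nat (s div 2 - e)) else 0) z * v\<^sub>1
     + poly (\<Sum>(a, s)\<leftarrow>M. if even s \<longleftrightarrow> (2::2) = 1 then monom (of_real a) (nat (s div 2 - e)) else 0) z * v\<^sub>2)"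
    if "\<forall>(a, s)\<in>set M. e \<le> s div 2" for M :: difference_eq and m
    using that
  proof (induction M)
    case (Cons x M)
    obtain a s where x: "x = (a, s)" by (cases x)
    have "z powi (m + s div 2) = z powi (m + e) * z ^ nat (s div 2 - e)"
    proof -
      have "z powi (m + s div 2) = z powi ((m + e) + int (nat (s div 2 - e)))"
        using Cons.prems x by simp
      also have "\<dots> = z powi (m + e) * z ^ nat (s div 2 - e)"
        using assms(1) by (subst power_int_add) (auto simp: power_int_def)
      finally show ?thesis .
    qed
    then show ?case
      using Cons x tm[of m s] by (simp add: poly_monom algebra_simps)
  qed simp
  have "\<forall>(a, s)\<in>set L. e \<le> s div 2"
    unfolding e_def lowest_power_def by (auto intro!: Min_le image_eqI)
  from split[OF this] show ?thesis
    unfolding satisfies_eq_def char_entry_def e_def[symmetric] using assms(1) by simp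
qed

definition char_matrix :: "nat \<Rightarrow> real \<Rightarrow> real \<Rightarrow> complex poly ^ 2 ^ 2" where
  "char_matrix k \<theta> d = (\<chi> i j. char_entry (linearized_eq k \<theta> d i) j)"

definition characteristic_poly :: "nat \<Rightarrow> real \<Rightarrow> real \<Rightarrow> complex poly" where
  "characteristic_poly k \<theta> d = det (char_matrix k \<theta> d)"

text \<open>\<open>Delta_odd k d\<close> is \<open>\<Delta>\<^bsub>2k+1\<^esub>\<close> and \<open>Delta_even k d\<close> is \<open>\<Delta>\<^bsub>2k+2\<^esub>\<close>,
  again with \<open>d = h'(\<alpha>)\<close>.\<close>

definition Delta_odd :: "nat \<Rightarrow> real \<Rightarrow> complex poly" where
  "Delta_odd k d =
     [:- 1, 1:] * monom 1 (2 * k) + monom (of_real (4 / d)) k - [:of_real (4 / d\<^sup>2):]"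

definition Delta_even :: "nat \<Rightarrow> real \<Rightarrow> complex poly" where
  "Delta_even k d =
     [:- 1, 1:] * monom 1 (2 * k + 1) + monom (of_real (4 / d)) (k + 1) + [:of_real (4 / d\<^sup>2):]"

end

theory Submission
  imports Defs
begin

text \<open>Write d = h'(\<alpha>), b = 2/d and p = \<lambda>^k (\<lambda> - 1). Everything reduces
  to a 2x2 determinant whose entries are built from p and b
  (\<open>char_entry_linearized_eq_lower\<close>, \<open>char_entry_linearized_eq_upper\<close>). It
  is (p + b)^2 - b^2 \<lambda> for \<theta> < 1/2 and \<lambda> (p + b)^2 - b^2 for \<theta> > 1/2.
  When the square is expanded, the terms in b^2 combine to b^2 (1 - \<lambda>), respectively b^2
  (\<lambda> - 1), while all other terms contain p. So \<lambda> - 1 splits off, and the opposite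
  signs of the constant terms in the two cofactors come from here; 2b = 4/d and b^2 = 4/d^2 give the
  coefficients.\<close>

lemma char_entry_linearized_eq_lower:
  fixes d :: real
  defines "b \<equiv> complex_of_real (2 / d)"
  assumes "\<theta> < 1/2"
  shows "char_entry (linearized_eq k \<theta> d 1) 1 = monom 1 k * [:- 1, 1:] + [:b:]"
    and "char_entry (linearized_eq k \<theta> d 1) 2 = [:b:]"
    and "char_entry (linearized_eq k \<theta> d 2) 1 = [:0, b:]"
    and "char_entry (linearized_eq k \<theta> d 2) 2 = monom 1 k * [:- 1, 1:] + [:b:]"
proof -
  \<comment> \<open>In both equations the most delayed terms have half-step index -2k or -2k + 1,
    and \<open>div 2\<close> sends both to -k.\<close>
  have low: "lowest_power (linearized_eq k \<theta> d i) = - int k" for i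
    using assms unfolding lowest_power_def linearized_eq_def by auto
  have "nat (1 + int k) = Suc k" by simp
  then show "char_entry (linearized_eq k \<theta> d 1) 1 = monom 1 k * [:- 1, 1:] + [:b:]"
    and "char_entry (linearized_eq k \<theta> d 1) 2 = [:b:]"
    and "char_entry (linearized_eq k \<theta> d 2) 1 = [:0, b:]"
    and "char_entry (linearized_eq k \<theta> d 2) 2 = monom 1 k * [:- 1, 1:] + [:b:]"
    using assms(2) unfolding char_entry_def low b_def
    by (auto simp: linearized_eq_def monom_altdef algebra_simps)
qed

text \<open>The first equation now reaches back to index -2k - 1 = 2(-k - 1) + 1, an odd sample of
  the preceding period. It is therefore divided by \<lambda>^(-k-1) and the second by
  \<lambda>^(-k), which puts the extra factor \<lambda> into the upper left entry.\<close>

lemma char_entry_linearized_eq_upper: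
  fixes d :: real
  defines "b \<equiv> complex_of_real (2 / d)"
  assumes "1/2 < \<theta>"
  shows "char_entry (linearized_eq k \<theta> d 1) 1 = [:0, 1:] * (monom 1 k * [:- 1, 1:] + [:b:])"
    and "char_entry (linearized_eq k \<theta> d 1) 2 = [:b:]"
    and "char_entry (linearized_eq k \<theta> d 2) 1 = [:b:]"
    and "char_entry (linearized_eq k \<theta> d 2) 2 = monom 1 k * [:- 1, 1:] + [:b:]"
proof -
  \<comment> \<open>Integer division rounds downwards, also for negative arguments.\<close>
  have odd_div: "(- 2 * int k - 1) div 2 = - int k - 1" by presburger
  have even_div: "- (int k * 2) div 2 = - int k" by presburger
  have low1: "lowest_power (linearized_eq k \<theta> d 1) = - int k - 1"
    and low2: "lowest_power (linearized_eq k \<theta> d 2) = - int k"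
    using assms odd_div unfolding lowest_power_def linearized_eq_def by auto
  \<comment> \<open>The undelayed terms sit at powers 1 and 0; subtracting the lowest power, -k - 1
    or -k, gives exponents k + 2 and k + 1, or k + 1 and k.\<close>
  have "nat (1 + int k) = Suc k" "nat (2 + int k) = Suc (Suc k)" by simp_all
  then show "char_entry (linearized_eq k \<theta> d 1) 1 = [:0, 1:] * (monom 1 k * [:- 1, 1:] + [:b:])"
    and "char_entry (linearized_eq k \<theta> d 1) 2 = [:b:]"
    and "char_entry (linearized_eq k \<theta> d 2) 1 = [:b:]"
    and "char_entry (linearized_eq k \<theta> d 2) 2 = monom 1 k * [:- 1, 1:] + [:b:]"
    using assms(2) odd_div even_div unfolding char_entry_def low1 low2 b_def
    by (auto simp: linearized_eq_def monom_altdef algebra_simps)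
qed

lemma characteristic_poly_lower:
  assumes "\<theta> < 1/2"
  shows "characteristic_poly k \<theta> d = [:- 1, 1:] * Delta_odd k d"
\<comment> \<open>Comparing values at every complex z turns monomials into powers of z, so that ring
  normalization settles the identity.\<close>
proof (rule poly_ext)
  fix z :: complex
  show "poly (characteristic_poly k \<theta> d) z = poly ([:- 1, 1:] * Delta_odd k d) z"
    unfolding characteristic_poly_def char_matrix_def Delta_odd_def det_2
    by (simp add: char_entry_linearized_eq_lower[OF assms] poly_monom power_mult power2_eq_square
        power_mult_distrib algebra_simps)
qed

lemma characteristic_poly_upper:
  assumes "1/2 < \<theta>"
  shows "characteristic_poly k \<theta> d = [:- 1, 1:] * Delta_even k d"
proof (rule poly_ext)
  fix z :: complex
  show "poly (characteristic_poly k \<theta> d) z = poly ([:- 1, 1:] * Delta_even k d) z"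
    unfolding characteristic_poly_def char_matrix_def Delta_even_def det_2
    by (simp add: char_entry_linearized_eq_upper[OF assms] poly_monom power_mult power2_eq_square
        power_mult_distrib algebra_simps)
qed

theorem theorem4p2:
  fixes k :: nat and \<theta> \<tau> c \<alpha> :: real and h :: "real \<Rightarrow> real"
  assumes "c \<ge> 0"
    and "\<tau> = real k + \<theta>"
    and "one_one_periodic_orbit \<tau> c \<alpha> h"
    and "\<forall>z. \<not> degenerate_zero h z"
    and "h differentiable (at \<alpha>)" and "deriv h \<alpha> > 0"
  shows "(0 < \<theta> \<and> \<theta> < 1/2 \<longrightarrow>
            characteristic_poly k \<theta> (deriv h \<alpha>) = [:- 1, 1:] * Delta_odd k (deriv h \<alpha>)) \<and>
         (1/2 < \<theta> \<and> \<theta> < 1 \<longrightarrow>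
            characteristic_poly k \<theta> (deriv h \<alpha>) = [:- 1, 1:] * Delta_even k (deriv h \<alpha>))"
  by (simp add: characteristic_poly_lower characteristic_poly_upper)

end
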